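(* Let $\mathcal{F}$ be a filter on $\omega$. Then $\mathcal{F}$ is $\mu_{\hat p}$-measurable if and only if $\mathcal{F}$ is $\mu_{\hat p}$-small.
   Context: Filters on $\omega$ are assumed nonprincipal and are identified with the set of characteristic functions of their elements, i.e. with subsets of $2^\omega$. For a sequence $\hat p = \{p_n : n\in\omega\}$ with $p_n \in (0,\tfrac12]$, $\mu_{\hat p}$ is the product measure on $2^\omega$ with $\mu_{\hat p}(\{x : x(n)=1\}) = p_n$ and $\mu_{\hat p}(\{x : x(n)=0\}) = 1-p_n$. A set $H\subseteq 2^\omega$ is $\mu_{\hat p}$-small if there exist a partition of $\omega$ into pairwise disjoint finite intervals $\{I_n : n\in\omega\}$ and sets $J_n\subseteq 2^{I_n}$ such that $H\subseteq\{x\in 2^\omega : \exists^\infty n\ x\restriction I_n\in J_n\}$ and $\sum_{n} \mu_{\hat p}(\{x\in 2^\omega : x\restriction I_n\in J_n\})<\infty$ (equivalently, the set $\{x : \exists^\infty n\ x\restriction I_n \in J_n\}$ has $\mu_{\hat p}$-measure zero). *)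

theory Defs
  imports "HOL-Probability.Probability"
begin

definition mu_p :: "(nat \<Rightarrow> real) \<Rightarrow> (nat \<Rightarrow> bool) measure" where
  "mu_p p = (\<Pi>\<^sub>M n\<in>UNIV. measure_pmf (bernoulli_pmf (p n)))"

definition mu_measurable :: "(nat \<Rightarrow> real) \<Rightarrow> (nat \<Rightarrow> bool) set \<Rightarrow> bool" where
  "mu_measurable p H \<longleftrightarrow> H \<in> sets (completion (mu_p p))"

definition mu_small :: "(nat \<Rightarrow> real) \<Rightarrow> (nat \<Rightarrow> bool) set \<Rightarrow> bool" where
  "mu_small p H \<longleftrightarrow>
     (\<exists>(I :: nat \<Rightarrow> nat set) (J :: nat \<Rightarrow> (nat \<Rightarrow> bool) set).
        (\<forall>n. \<exists>a b. a < b \<and> I n = {a..<b}) \<and>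
        disjoint_family I \<and> (\<Union>n. I n) = UNIV \<and>
        (\<forall>n. J n \<subseteq> (I n \<rightarrow>\<^sub>E (UNIV :: bool set))) \<and>
        H \<subseteq> {x. \<exists>\<^sub>\<infinity>n. restrict x (I n) \<in> J n} \<and>
        (\<Sum>n. emeasure (mu_p p) {x \<in> space (mu_p p). restrict x (I n) \<in> J n}) < \<infinity>)"

text \<open>A filter on omega, identified with the set of characteristic functions
  of its elements.\<close>
definition filter_chars :: "nat filter \<Rightarrow> (nat \<Rightarrow> bool) set" where
  "filter_chars F = {x. eventually x F}"

end

theory Submission
  imports Defs
begin

text \<open>Small sets are null by Borel--Cantelli. Conversely, a measurable filter is null: a subset of
  positive measure would, after changing finitely many coordinates, give a measurable subset of the
  filter of measure above \<open>1/2\<close>, and such a set contains two disjoint elements. A null filter is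
  covered by the limit superior of events \<open>B k\<close> depending on the adjacent blocks \<open>k\<close> and \<open>k + 1\<close>
  of a partition into intervals. Every such event is cut along the even block: by Markov's inequality
  the set of configurations on the even block with a large section in the odd block is itself
  of small measure. Since a filter is closed under splicing two of its elements, either these
  exceptional configurations or the sections at one fixed element witness smallness.\<close>

section \<open>Outer approximation of finite measures\<close>

text \<open>By Caratheodory's theorem the outer measure is a measure on the generated sigma-algebra.
  It agrees with \<open>N\<close> on \<open>M\<close>, which is stable under intersections, so
  uniqueness of finite measures identifies the two.\<close>

lemma (in ring_of_sets) outer_measure_eq_emeasure:
  assumes N: "sets N = sigma_sets \<Omega> M" and fin: "finite_measure N" and top: "\<Omega> \<in> M"
    and S: "S \<in> sets N"
  shows "outer_measure M (emeasure N) S = emeasure N S"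
proof -
  let ?f = "emeasure N" and ?O = "outer_measure M (emeasure N)"
  have sub: "M \<subseteq> sets N"
    by (auto simp: N)
  have pos: "positive M ?f"
    by (simp add: positive_def)
  have ca: "countably_additive M ?f"
    using sub by (auto simp: countably_additive_def intro!: suminf_emeasure)
  have inc: "increasing M ?f"
    using sub by (auto simp: increasing_def intro!: emeasure_mono)
  have add: "additive M ?f"
    using pos ca by (rule countably_additive_additive)
  have ms: "measure_space \<Omega> (lambda_system \<Omega> (Pow \<Omega>) ?O) ?O"
    by (rule sigma_algebra.caratheodory_lemma[OF sigma_algebra_Pow
          outer_measure_space_outer_measure[OF pos inc]])
  then have "sigma_sets \<Omega> M \<subseteq> lambda_system \<Omega> (Pow \<Omega>) ?O"
    using sigma_algebra.sigma_sets_subset algebra_subset_lambda_system[OF pos inc add]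
    by (metis measure_space_def)
  then have ms': "measure_space \<Omega> (sigma_sets \<Omega> M) ?O"
    by (rule measure_down[OF ms sigma_algebra_sigma_sets[OF space_closed]])
  let ?N = "measure_of \<Omega> (sigma_sets \<Omega> M) ?O"
  have [simp]: "sets ?N = sigma_sets \<Omega> M"
    using sigma_sets_into_sp[OF space_closed]
    by (subst sets_measure_of) (auto simp: sigma_sets_sigma_sets_eq[OF space_closed])
  have em: "emeasure ?N A = ?O A" if "A \<in> sigma_sets \<Omega> M" for A
    using that ms' by (intro emeasure_measure_of_sigma) (auto simp: measure_space_def)
  have "N = ?N"
  proof (rule measure_eqI_generator_eq[where E = M and \<Omega> = \<Omega> and A = "\<lambda>_. \<Omega>"])
    show "Int_stable M"
      by (auto simp: Int_stable_def)
    show "emeasure N X = emeasure ?N X" if "X \<in> M" for X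
      using that outer_measure_agrees[OF pos ca that] by (subst em) auto
  qed (use N top space_closed fin in \<open>simp_all add: finite_measure.emeasure_finite\<close>)
  then show ?thesis
    using em S N by metis
qed

text \<open>The outer measure is an infimum over countable covers, so some disjoint cover comes
  within \<open>e\<close> of it. Finiteness turns the sums into real series.\<close>

lemma (in ring_of_sets) finite_measure_cover:
  assumes N: "sets N = sigma_sets \<Omega> M" and fin: "finite_measure N" and top: "\<Omega> \<in> M"
    and S: "S \<in> sets N" and e: "e > 0"
  obtains C :: "nat \<Rightarrow> 'a set" where "range C \<subseteq> M" "disjoint_family C" "S \<subseteq> (\<Union>i. C i)"
    "summable (\<lambda>i. measure N (C i))" "(\<Sum>i. measure N (C i)) < measure N S + e"
proof -
  interpret finite_measure N by fact
  have "outer_measure M (emeasure N) S < emeasure N S + ennreal e"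
    using e by (subst outer_measure_eq_emeasure[OF N fin top S])
      (simp add: emeasure_eq_measure flip: ennreal_plus, simp add: ennreal_less_iff)
  then obtain C where C: "range C \<subseteq> M" "disjoint_family C" "S \<subseteq> (\<Union>i. C i)"
      "(\<Sum>i. emeasure N (C i)) < emeasure N S + ennreal e"
    by (blast dest: outer_measure_close)
  have lt: "(\<Sum>i. ennreal (measure N (C i))) < ennreal (measure N S + e)"
    using C(4) e by (simp add: emeasure_eq_measure flip: ennreal_plus)
  then have sm: "summable (\<lambda>i. measure N (C i))"
    by (intro summable_suminf_not_top) (auto simp: top_unique)
  then have "(\<Sum>i. measure N (C i)) < measure N S + e"
    using lt by (simp add: suminf_ennreal2 suminf_nonneg ennreal_less_iff)
  with C sm that show thesis
    by blast
qed

section \<open>Splicing and dependence on a set of coordinates\<close>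

definition splice :: "'i set \<Rightarrow> ('i \<Rightarrow> 'a) \<Rightarrow> ('i \<Rightarrow> 'a) \<Rightarrow> 'i \<Rightarrow> 'a" where
  "splice A x y = (\<lambda>i. if i \<in> A then x i else y i)"

text \<open>One implication suffices, since exchanging \<open>x\<close> and \<open>y\<close> gives
  the converse.\<close>

definition determined_by :: "'i set \<Rightarrow> ('i \<Rightarrow> 'a) set \<Rightarrow> bool" where
  "determined_by A S \<longleftrightarrow> (\<forall>x y. (\<forall>i\<in>A. x i = y i) \<longrightarrow> x \<in> S \<longrightarrow> y \<in> S)"

definition cylinder :: "nat \<Rightarrow> (nat \<Rightarrow> 'a) \<Rightarrow> (nat \<Rightarrow> 'a) set" where
  "cylinder n s = {x. \<forall>i<n. x i = s i}"

lemma splice_in [simp]: "i \<in> A \<Longrightarrow> splice A x y i = x i"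
  and splice_notin [simp]: "i \<notin> A \<Longrightarrow> splice A x y i = y i"
  by (simp_all add: splice_def)

lemma determined_byD:
  "determined_by A S \<Longrightarrow> (\<And>i. i \<in> A \<Longrightarrow> x i = y i) \<Longrightarrow> x \<in> S \<longleftrightarrow> y \<in> S"
  unfolding determined_by_def by (metis (no_types))

lemma determined_by_mono: "determined_by A S \<Longrightarrow> A \<subseteq> B \<Longrightarrow> determined_by B S"
  unfolding determined_by_def by blast

lemma determined_by_Un: "determined_by A S \<Longrightarrow> determined_by A T \<Longrightarrow> determined_by A (S \<union> T)"
  unfolding determined_by_def by blast

lemma determined_by_UN: "(\<And>i. i \<in> I \<Longrightarrow> determined_by A (S i)) \<Longrightarrow> determined_by A (\<Union>i\<in>I. S i)"
  unfolding determined_by_def by blast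

text \<open>A configuration on the first \<open>n\<close> coordinates is coded by its set
  \<open>B\<close> of successes. There are only finitely many, which makes such events
  measurable.\<close>

lemma determined_by_eq_UN_cylinder:
  fixes S :: "(nat \<Rightarrow> bool) set"
  assumes "determined_by {..<n} S"
  shows "S = (\<Union>B\<in>{B. B \<subseteq> {..<n} \<and> (\<lambda>i. i \<in> B) \<in> S}. cylinder n (\<lambda>i. i \<in> B))"
proof safe
  fix x assume "x \<in> S"
  then have "(\<lambda>i. i \<in> {i. i < n \<and> x i}) \<in> S"
    by (subst determined_byD[OF assms, of _ x]) auto
  then show "x \<in> (\<Union>B\<in>{B. B \<subseteq> {..<n} \<and> (\<lambda>i. i \<in> B) \<in> S}. cylinder n (\<lambda>i. i \<in> B))"
    by (intro UN_I[of "{i. i < n \<and> x i}"]) (auto simp: cylinder_def)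
next
  fix x B assume "(\<lambda>i. i \<in> B) \<in> S" "x \<in> cylinder n (\<lambda>i. i \<in> B)"
  then show "x \<in> S"
    by (subst determined_byD[OF assms, of _ "\<lambda>i. i \<in> B"]) (auto simp: cylinder_def)
qed

section \<open>The biased product measure and its sections\<close>

locale biased_coins =
  fixes p :: "nat \<Rightarrow> real"
  assumes p_pos: "0 < p n" and p_le: "p n \<le> 1/2"
begin

abbreviation M :: "(nat \<Rightarrow> bool) measure" where
  "M \<equiv> mu_p p"

sublocale P: product_prob_space "\<lambda>n. measure_pmf (bernoulli_pmf (p n))" UNIV
  by unfold_locales

sublocale M: prob_space M
  unfolding mu_p_def by (rule P.prob_space_axioms)

lemma space_M [simp]: "space M = UNIV"
  by (simp add: mu_p_def space_PiM)

lemma measurable_M: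
  assumes "\<And>i. (\<lambda>w. f w i) \<in> measurable N (count_space UNIV)"
  shows "f \<in> measurable N M"
  unfolding mu_p_def
proof (rule measurable_PiM_single')
  show "(\<lambda>w. f w i) \<in> measurable N (measure_pmf (bernoulli_pmf (p i)))" for i
    using assms by (simp add: measurable_cong_sets[OF refl sets_measure_pmf_count_space])
qed auto

lemma measurable_coord [measurable]: "(\<lambda>x. x i) \<in> measurable M (count_space UNIV)"
proof -
  have "(\<lambda>x. x i) \<in> measurable M (measure_pmf (bernoulli_pmf (p i)))"
    unfolding mu_p_def by measurable
  then show ?thesis
    by (simp add: measurable_cong_sets[OF refl sets_measure_pmf_count_space])
qed

text \<open>The values on finite-dimensional rectangles determine the product measure.\<close>

lemma distr_eq_M:
  assumes [measurable]: "f \<in> measurable N M"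
    and eq: "\<And>J E. finite J \<Longrightarrow> emeasure N {w \<in> space N. \<forall>j\<in>J. f w j \<in> E j}
      = (\<Prod>j\<in>J. emeasure (measure_pmf (bernoulli_pmf (p j))) (E j))"
  shows "distr N M f = M"
proof -
  have "distr N M f = (\<Pi>\<^sub>M n\<in>UNIV. measure_pmf (bernoulli_pmf (p n)))"
  proof (rule P.PiM_eq)
    fix J :: "nat set" and E :: "nat \<Rightarrow> bool set" assume J: "finite J"
    let ?X = "prod_emb UNIV (\<lambda>n. measure_pmf (bernoulli_pmf (p n))) J (\<Pi>\<^sub>E j\<in>J. E j)"
    have X: "?X = {x. \<forall>j\<in>J. x j \<in> E j}"
      by (auto simp: prod_emb_def PiE_iff)
    have "?X \<in> sets M"
      unfolding mu_p_def using J by (intro sets_PiM_I) auto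
    then show "emeasure (distr N M f) ?X = (\<Prod>j\<in>J. emeasure (measure_pmf (bernoulli_pmf (p j))) (E j))"
      unfolding eq[OF J, symmetric] by (subst emeasure_distr) (auto simp: X intro!: arg_cong[where f="emeasure N"])
  qed (simp add: mu_p_def)
  then show ?thesis by (simp add: mu_p_def)
qed

lemma emeasure_M_Collect:
  "finite J \<Longrightarrow> emeasure M {x. \<forall>j\<in>J. x j \<in> E j}
    = (\<Prod>j\<in>J. emeasure (measure_pmf (bernoulli_pmf (p j))) (E j))"
  using P.emeasure_PiM_Collect[of J E] by (simp add: mu_p_def space_PiM)

lemma cylinder_sets [measurable]: "cylinder n s \<in> sets M"
proof -
  have "{x \<in> space M. \<forall>i\<in>{..<n}. x i = s i} \<in> sets M"
    by measurable
  then show ?thesis by (simp add: cylinder_def lessThan_def)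
qed

lemma determined_by_sets: "determined_by {..<n} S \<Longrightarrow> S \<in> sets M"
  by (subst determined_by_eq_UN_cylinder) (auto intro!: sets.finite_UN)

text \<open>Because \<open>p i\<close> is at most 1/2, it is the smaller of the two weights at
  coordinate \<open>i\<close>. The bound is positive and uniform in \<open>s\<close>, which later
  permits dropping the dependence on the first coordinates.\<close>

lemma measure_cylinder_ge: "(\<Prod>i<n. p i) \<le> measure M (cylinder n s)"
proof -
  have "emeasure M (cylinder n s) = (\<Prod>i<n. emeasure (measure_pmf (bernoulli_pmf (p i))) {s i})"
    using emeasure_M_Collect[of "{..<n}" "\<lambda>i. {s i}"] by (simp add: cylinder_def lessThan_def)
  also have "\<dots> = ennreal (\<Prod>i<n. pmf (bernoulli_pmf (p i)) (s i))"
    by (simp add: emeasure_pmf_single prod_ennreal)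
  finally have "measure M (cylinder n s) = (\<Prod>i<n. pmf (bernoulli_pmf (p i)) (s i))"
    by (simp add: measure_def prod_nonneg)
  also have "\<dots> \<ge> (\<Prod>i<n. p i)"
  proof (rule prod_mono)
    show "0 \<le> p i \<and> p i \<le> pmf (bernoulli_pmf (p i)) (s i)" for i
      using p_pos[of i] p_le[of i] by (cases "s i") auto
  qed
  finally show ?thesis .
qed

lemma measurable_splice: "(\<lambda>(x, y). splice A x y) \<in> measurable (M \<Otimes>\<^sub>M M) M"
  by (rule measurable_M) (auto simp: splice_def split_beta')

lemma measurable_splice_right [measurable]: "splice A x \<in> measurable M M"
  by (rule measurable_M) (auto simp: splice_def)

text \<open>The coordinates in \<open>A\<close> and those outside come from independent copies, so
  the product over \<open>J\<close> splits into those over \<open>J \<inter> A\<close> and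
  \<open>J - A\<close>.\<close>

lemma distr_splice: "distr (M \<Otimes>\<^sub>M M) M (\<lambda>(x, y). splice A x y) = M"
proof (rule distr_eq_M[OF measurable_splice])
  fix J :: "nat set" and E :: "nat \<Rightarrow> bool set" assume J: "finite J"
  let ?m = "\<lambda>j. emeasure (measure_pmf (bernoulli_pmf (p j))) (E j)"
  have meas: "{x. \<forall>j\<in>J'. x j \<in> E j} \<in> sets M" if "finite J'" for J'
  proof -
    have "{x \<in> space M. \<forall>j\<in>J'. x j \<in> E j} \<in> sets M"
      using that by measurable
    then show ?thesis by simp
  qed
  have "{w \<in> space (M \<Otimes>\<^sub>M M). \<forall>j\<in>J. (case w of (x, y) \<Rightarrow> splice A x y) j \<in> E j}
      = {x. \<forall>j\<in>J \<inter> A. x j \<in> E j} \<times> {x. \<forall>j\<in>J - A. x j \<in> E j}"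
    by (auto simp: space_pair_measure) (case_tac "j \<in> A"; simp)
  then have "emeasure (M \<Otimes>\<^sub>M M) {w \<in> space (M \<Otimes>\<^sub>M M). \<forall>j\<in>J. (case w of (x, y) \<Rightarrow> splice A x y) j \<in> E j}
      = emeasure M {x. \<forall>j\<in>J \<inter> A. x j \<in> E j} * emeasure M {x. \<forall>j\<in>J - A. x j \<in> E j}"
    using J by (simp add: M.emeasure_pair_measure_Times meas)
  also have "\<dots> = (\<Prod>j\<in>J \<inter> A. ?m j) * (\<Prod>j\<in>J - A. ?m j)"
    using J by (simp add: emeasure_M_Collect)
  also have "\<dots> = (\<Prod>j\<in>J. ?m j)"
    by (rule prod.Int_Diff[OF J, symmetric])
  finally show "emeasure (M \<Otimes>\<^sub>M M) {w \<in> space (M \<Otimes>\<^sub>M M). \<forall>j\<in>J. (case w of (x, y) \<Rightarrow> splice A x y) j \<in> E j}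
      = (\<Prod>j\<in>J. ?m j)" .
qed

lemma section_sets: "S \<in> sets M \<Longrightarrow> {y. splice A x y \<in> S} \<in> sets M"
  using measurable_sets[OF measurable_splice_right, of S A x] by (simp add: vimage_def)

lemma section_measurable:
  assumes S: "S \<in> sets M"
  shows "(\<lambda>x. emeasure M {y. splice A x y \<in> S}) \<in> borel_measurable M"
proof -
  have "Pair x -` ((\<lambda>(x, y). splice A x y) -` S \<inter> space (M \<Otimes>\<^sub>M M)) = {y. splice A x y \<in> S}" for x
    by (auto simp: space_pair_measure)
  then show ?thesis
    using M.measurable_emeasure_Pair[OF measurable_sets[OF measurable_splice[of A] S]] by simp
qed

text \<open>Fubini's theorem, transported along \<open>distr_splice\<close>.\<close>

lemma emeasure_eq_integral_section:
  assumes S: "S \<in> sets M"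
  shows "emeasure M S = (\<integral>\<^sup>+x. emeasure M {y. splice A x y \<in> S} \<partial>M)"
proof -
  have "emeasure M S = emeasure (distr (M \<Otimes>\<^sub>M M) M (\<lambda>(x, y). splice A x y)) S"
    by (simp add: distr_splice)
  also have "\<dots> = emeasure (M \<Otimes>\<^sub>M M) ((\<lambda>(x, y). splice A x y) -` S \<inter> space (M \<Otimes>\<^sub>M M))"
    by (rule emeasure_distr[OF measurable_splice S])
  also have "\<dots> = (\<integral>\<^sup>+x. emeasure M {y. splice A x y \<in> S} \<partial>M)"
    by (subst M.emeasure_pair_measure_alt[OF measurable_sets[OF measurable_splice S]])
      (auto intro!: nn_integral_cong arg_cong[where f="emeasure M"] simp: space_pair_measure)
  finally show ?thesis .
qed

text \<open>Markov's inequality for the section measure, whose integral is the measure of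
  \<open>S\<close>.\<close>

lemma measure_large_section_le:
  assumes S: "S \<in> sets M" and d: "d > 0"
  shows "{x. d \<le> measure M {y. splice A x y \<in> S}} \<in> sets M"
    and "measure M {x. d \<le> measure M {y. splice A x y \<in> S}} \<le> measure M S / d"
proof -
  let ?u = "\<lambda>x. emeasure M {y. splice A x y \<in> S}"
  have [measurable]: "?u \<in> borel_measurable M"
    by (rule section_measurable[OF S])
  have eq: "{x. d \<le> measure M {y. splice A x y \<in> S}} = {x \<in> space M. ennreal d \<le> ?u x}"
    using d by (auto simp: M.emeasure_eq_measure)
  show "{x. d \<le> measure M {y. splice A x y \<in> S}} \<in> sets M"
    unfolding eq by measurable
  have eq2: "{x. d \<le> measure M {y. splice A x y \<in> S}} = {x \<in> space M. 1 \<le> ennreal (1/d) * ?u x}"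
    using d by (simp add: M.emeasure_eq_measure pos_le_divide_eq flip: ennreal_mult' ennreal_1)
  have "emeasure M {x. d \<le> measure M {y. splice A x y \<in> S}}
      \<le> ennreal (1/d) * (\<integral>\<^sup>+x. ?u x * indicator (space M) x \<partial>M)"
    unfolding eq2 by (rule nn_integral_Markov_inequality[OF _ sets.top]) simp
  also have "\<dots> = ennreal (1/d) * emeasure M S"
    by (subst emeasure_eq_integral_section[OF S, of A]) simp
  finally show "measure M {x. d \<le> measure M {y. splice A x y \<in> S}} \<le> measure M S / d"
    using d by (simp add: M.emeasure_eq_measure flip: ennreal_mult')
qed

text \<open>Outside \<open>A\<close> the spliced point is supplied by \<open>y\<close>, which the
  measure integrates out; \<open>x\<close> enters only through \<open>A \<inter> C\<close>.\<close>

lemma determined_by_large_section: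
  assumes "determined_by C S"
  shows "determined_by (A \<inter> C) {x. d \<le> measure M {y. splice A x y \<in> S}}"
proof -
  have "{z. splice A x z \<in> S} = {z. splice A y z \<in> S}" if "\<forall>i\<in>A \<inter> C. x i = y i" for x y
    using that by (intro Collect_cong determined_byD[OF assms]) (simp add: splice_def)
  then show ?thesis
    unfolding determined_by_def by (metis mem_Collect_eq)
qed

lemma determined_by_section: "determined_by C S \<Longrightarrow> determined_by (C - A) {y. splice A x y \<in> S}"
proof -
  assume S: "determined_by C S"
  have "splice A x y \<in> S \<longleftrightarrow> splice A x z \<in> S" if "\<forall>i\<in>C - A. y i = z i" for y z
    using that by (intro determined_byD[OF S]) (simp add: splice_def)
  then show ?thesis
    unfolding determined_by_def by blast
qed

section \<open>Covers by events of finitely many coordinates\<close>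

lemma algebra_determined: "algebra UNIV {S :: (nat \<Rightarrow> bool) set. \<exists>n. determined_by {..<n} S}"
  unfolding algebra_iff_Un
proof (intro conjI ballI)
  fix S T :: "(nat \<Rightarrow> bool) set"
  assume "S \<in> {S. \<exists>n. determined_by {..<n} S}" "T \<in> {S. \<exists>n. determined_by {..<n} S}"
  then obtain m n where "determined_by {..<m} S" "determined_by {..<n} T"
    by auto
  then have "determined_by {..<max m n} (S \<union> T)"
    by (intro determined_by_Un) (auto elim!: determined_by_mono)
  then show "S \<union> T \<in> {S. \<exists>n. determined_by {..<n} S}"
    by blast
next
  fix S :: "(nat \<Rightarrow> bool) set" assume "S \<in> {S. \<exists>n. determined_by {..<n} S}"
  then obtain n where n: "determined_by {..<n} S" by blast
  then have "determined_by {..<n} (UNIV - S)"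
    using determined_byD[OF n] unfolding determined_by_def by blast
  then show "UNIV - S \<in> {S. \<exists>n. determined_by {..<n} S}"
    by blast
qed (auto simp: determined_by_def)

lemma sets_M_eq: "sets M = sigma_sets UNIV {S. \<exists>n. determined_by {..<n} S}"
proof
  show "sigma_sets UNIV {S. \<exists>n. determined_by {..<n} S} \<subseteq> sets M"
    using sets.sigma_sets_subset[of "{S. \<exists>n. determined_by {..<n} S}" M]
    by (auto dest: determined_by_sets)
  have "sets M = sigma_sets UNIV {{x. x i \<in> E} | i E. True}"
    unfolding mu_p_def sets_PiM_single by simp
  also have "\<dots> \<subseteq> sigma_sets UNIV {S. \<exists>n. determined_by {..<n} S}"
  proof (rule sigma_sets_mono', safe)
    fix i :: nat and E :: "bool set"
    show "\<exists>n. determined_by {..<n} {x. x i \<in> E}"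
      by (intro exI[of _ "Suc i"]) (simp add: determined_by_def)
  qed
  finally show "sets M \<subseteq> sigma_sets UNIV {S. \<exists>n. determined_by {..<n} S}" .
qed

lemma finite_coordinate_cover:
  assumes "S \<in> sets M" "e > 0"
  obtains C where "\<And>i::nat. \<exists>n. determined_by {..<n} (C i)" "S \<subseteq> (\<Union>i. C i)"
    "summable (\<lambda>i. measure M (C i))" "(\<Sum>i. measure M (C i)) < measure M S + e"
proof -
  interpret A: algebra UNIV "{S :: (nat \<Rightarrow> bool) set. \<exists>n. determined_by {..<n} S}"
    by (rule algebra_determined)
  obtain C :: "nat \<Rightarrow> (nat \<Rightarrow> bool) set" where C: "range C \<subseteq> {S. \<exists>n. determined_by {..<n} S}"
      "S \<subseteq> (\<Union>i. C i)" "summable (\<lambda>i. measure M (C i))" "(\<Sum>i. measure M (C i)) < measure M S + e"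
    using A.finite_measure_cover[OF sets_M_eq M.finite_measure_axioms A.top assms] by metis
  have "\<exists>n. determined_by {..<n} (C i)" for i
    using C(1) by (simp add: image_subset_iff)
  then show thesis
    using C(2-4) by (rule that)
qed

section \<open>Measurable filters are null\<close>

text \<open>Resampling the coordinates from \<open>n\<close> on does not affect membership in
  \<open>D\<close>, so the bound on the sections is integrated over \<open>D\<close> only.\<close>

lemma measure_Int_le_section:
  assumes S: "S \<in> sets M" and D: "determined_by {..<n} D" and r: "0 \<le> r"
    and le: "\<And>x. measure M {y. splice {..<n} x y \<in> S} \<le> r"
  shows "measure M (S \<inter> D) \<le> r * measure M D"
proof -
  have [measurable]: "D \<in> sets M"
    by (rule determined_by_sets[OF D])
  have sec: "splice {..<n} x y \<in> D \<longleftrightarrow> x \<in> D" for x y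
    by (rule determined_byD[OF D]) simp
  have "emeasure M (S \<inter> D) = (\<integral>\<^sup>+x. emeasure M {y. splice {..<n} x y \<in> S \<inter> D} \<partial>M)"
    using S by (intro emeasure_eq_integral_section) auto
  also have "\<dots> \<le> (\<integral>\<^sup>+x. ennreal r * indicator D x \<partial>M)"
    using le by (intro nn_integral_mono) (auto simp: sec M.emeasure_eq_measure split: split_indicator intro: ennreal_leI)
  also have "\<dots> = ennreal r * emeasure M D"
    by (simp add: nn_integral_cmult_indicator)
  finally show ?thesis
    using r by (simp add: M.emeasure_eq_measure flip: ennreal_mult)
qed

text \<open>A weak form of Lebesgue density. If no section exceeded 1/2, then \<open>S\<close> would
  fill at most half of each member of a cover of total measure below twice that of \<open>S\<close>,
  which is too little to exhaust \<open>S\<close>.\<close>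

lemma exists_large_section:
  assumes S: "S \<in> sets M" and pos: "0 < measure M S"
  obtains n x where "1/2 < measure M {y. splice {..<n} x y \<in> S}"
proof (rule ccontr)
  assume "\<not> thesis"
  then have le: "measure M {y. splice {..<n} x y \<in> S} \<le> 1/2" for n x
    using that not_le by blast
  obtain C where C: "\<And>i::nat. \<exists>n. determined_by {..<n} (C i)" "S \<subseteq> (\<Union>i. C i)"
      "summable (\<lambda>i. measure M (C i))" "(\<Sum>i. measure M (C i)) < measure M S + measure M S"
    using finite_coordinate_cover[OF S pos] by blast
  have half: "measure M (S \<inter> C i) \<le> 1/2 * measure M (C i)" for i
    using C(1)[of i] measure_Int_le_section[OF S _ _ le] by auto
  have sm: "summable (\<lambda>i. measure M (S \<inter> C i))"
    using C(3) half by (intro summable_comparison_test'[OF summable_mult[OF C(3), of "1/2"]]) auto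
  have "measure M S = measure M (\<Union>i. S \<inter> C i)"
    using C(2) by (intro arg_cong[where f="measure M"]) blast
  also have "\<dots> \<le> (\<Sum>i. measure M (S \<inter> C i))"
    using S C(1) sm by (intro M.finite_measure_subadditive_countably) (auto dest: determined_by_sets)
  also have "\<dots> \<le> (\<Sum>i. 1/2 * measure M (C i))"
    by (intro suminf_le half sm summable_mult C(3))
  also have "\<dots> < measure M S"
    using C(4) by (subst suminf_mult[OF C(3)]) simp
  finally show False by simp
qed

text \<open>Splitting each success of a coin with bias \<open>2 p n\<close> by a fair coin couples two copies of the
  measure so that their sets of successes are disjoint; this is where \<open>p n \<le> 1/2\<close> is needed.\<close>

lemma exists_disjoint_pair:
  assumes T: "T \<in> sets M" and gt: "1/2 < measure M T"
  obtains x y where "x \<in> T" "y \<in> T" "\<And>i. \<not> (x i \<and> y i)"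
proof -
  define q where "q i = pair_pmf (bernoulli_pmf (2 * p i)) (bernoulli_pmf (1/2))" for i
  define N where "N = (\<Pi>\<^sub>M i\<in>(UNIV::nat set). measure_pmf (q i))"
  interpret Q: product_prob_space "\<lambda>i. measure_pmf (q i)" "UNIV :: nat set"
    by unfold_locales
  interpret N: prob_space N
    unfolding N_def by (rule Q.prob_space_axioms)
  have sp: "space N = UNIV"
    by (simp add: N_def space_PiM)
  have meas: "(\<lambda>w i. h (w i)) \<in> measurable N M" for h :: "bool \<times> bool \<Rightarrow> bool"
  proof (rule measurable_M)
    fix i
    have "(\<lambda>w. w i) \<in> measurable N (measure_pmf (q i))"
      unfolding N_def by measurable
    then show "(\<lambda>w. h (w i)) \<in> measurable N (count_space UNIV)"
      by (rule measurable_compose) simp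
  qed
  have distr: "distr N M (\<lambda>w i. h (w i)) = M"
    if h: "\<And>i. map_pmf h (q i) = bernoulli_pmf (p i)" for h :: "bool \<times> bool \<Rightarrow> bool"
  proof (rule distr_eq_M[OF meas])
    fix J :: "nat set" and E :: "nat \<Rightarrow> bool set" assume "finite J"
    then have "emeasure N {w \<in> space N. \<forall>j\<in>J. h (w j) \<in> E j} = (\<Prod>j\<in>J. emeasure (measure_pmf (q j)) (h -` E j))"
      using Q.emeasure_PiM_Collect[of J "\<lambda>j. h -` E j"] by (simp add: N_def)
    then show "emeasure N {w \<in> space N. \<forall>j\<in>J. h (w j) \<in> E j}
        = (\<Prod>j\<in>J. emeasure (measure_pmf (bernoulli_pmf (p j))) (E j))"
      by (simp flip: h)
  qed
  have p01: "0 \<le> p i" "p i \<le> 1" "0 \<le> 2 * p i" "2 * p i \<le> 1" for i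
    using p_pos[of i] p_le[of i] by auto
  \<comment> \<open>A distribution on \<open>bool\<close> is determined by its mass at
    \<open>True\<close>.\<close>
  have bern: "P = bernoulli_pmf (p i)" if "pmf P True = p i" for P i
    using that p01 by (intro pmf_eqI) (metis (full_types) pmf_bernoulli_True pmf_False_conv_True)
  have half: "measure N ((\<lambda>w i. h (w i)) -` T) > 1/2"
    if h: "\<And>i. map_pmf h (q i) = bernoulli_pmf (p i)" for h
    using gt measure_distr[OF meas T, of h] by (simp add: distr[OF h] sp)
  let ?X = "(\<lambda>w i. (\<lambda>(b, c). b \<and> c) (w i)) -` T" and ?Y = "(\<lambda>w i. (\<lambda>(b, c). b \<and> \<not> c) (w i)) -` T"
  have X: "measure N ?X > 1/2"
    using p01 by (intro half bern)
      (simp add: q_def pair_pmf_def map_bind_pmf pmf_bind measure_pmf_single)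
  have Y: "measure N ?Y > 1/2"
    using p01 by (intro half bern)
      (simp add: q_def pair_pmf_def map_bind_pmf pmf_bind measure_pmf_single)
  have XY: "?X \<in> sets N" "?Y \<in> sets N"
    using measurable_sets[OF meas T] by (simp_all add: sp)
  \<comment> \<open>Two events of probability above 1/2 on the same space must meet; a common point
    \<open>w\<close> yields both configurations at once.\<close>
  have "?X \<inter> ?Y \<noteq> {}"
  proof
    assume "?X \<inter> ?Y = {}"
    then have "measure N (?X \<union> ?Y) = measure N ?X + measure N ?Y"
      using XY by (intro N.finite_measure_Union)
    with X Y N.prob_le_1[of "?X \<union> ?Y"] show False
      by simp
  qed
  then obtain w where w: "w \<in> ?X" "w \<in> ?Y" by blast
  show thesis
    by (rule that[of "\<lambda>i. (\<lambda>(b, c). b \<and> c) (w i)" "\<lambda>i. (\<lambda>(b, c). b \<and> \<not> c) (w i)"])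
      (use w in \<open>auto split: prod.splits\<close>)
qed

lemma measure_subset_filter_eq_0:
  assumes F: "F \<noteq> bot" "F \<le> cofinite" and S: "S \<in> sets M" "S \<subseteq> filter_chars F"
  shows "measure M S = 0"
proof (rule ccontr)
  assume "measure M S \<noteq> 0"
  then have "0 < measure M S"
    by (simp add: zero_less_measure_iff)
  then obtain n x where x: "1/2 < measure M {y. splice {..<n} x y \<in> S}"
    using exists_large_section[OF S(1)] by blast
  obtain y z where yz: "splice {..<n} x y \<in> S" "splice {..<n} x z \<in> S" "\<And>i. \<not> (y i \<and> z i)"
    using exists_disjoint_pair[OF section_sets[OF S(1)] x] by blast
  \<comment> \<open>The section lies in the filter as well: overwriting the coordinates below
    \<open>n\<close> is invisible to a filter below \<open>cofinite\<close>.\<close>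
  have ev: "eventually y F" if "splice {..<n} x y \<in> S" for y
  proof -
    have "eventually (\<lambda>i. i \<notin> {..<n}) F"
      using F(2) by (rule filter_leD) (simp add: eventually_cofinite lessThan_def)
    moreover have "eventually (splice {..<n} x y) F"
      using that S(2) by (auto simp: filter_chars_def)
    ultimately show ?thesis
      by eventually_elim (simp add: splice_def)
  qed
  have "eventually (\<lambda>i. False) F"
    using ev[OF yz(1)] ev[OF yz(2)] by eventually_elim (use yz(3) in auto)
  with F(1) show False by simp
qed

lemma filter_subset_null_set:
  assumes F: "F \<noteq> bot" "F \<le> cofinite" and meas: "filter_chars F \<in> sets (completion M)"
  obtains N where "N \<in> null_sets M" "filter_chars F \<subseteq> N"
proof -
  obtain S N N' where N: "filter_chars F = S \<union> N" "N \<subseteq> N'" "N' \<in> null_sets M" "S \<in> sets M"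
    using meas by (rule sets_completionE)
  have "measure M S = 0"
    using N by (intro measure_subset_filter_eq_0[OF F]) auto
  then have "S \<in> null_sets M"
    using N(4) by (auto simp: M.emeasure_eq_measure)
  then show thesis
    using N by (intro that[of "S \<union> N'"]) auto
qed

section \<open>Borel-Cantelli covers of null sets\<close>

text \<open>For every \<open>k\<close> take a cover of total measure below \<open>(1/2)^k\<close>
  and enumerate all of them as one sequence. A point of \<open>N\<close> is covered at each level
  \<open>k\<close>, hence infinitely often.\<close>

lemma null_set_infinitely_covered:
  assumes N: "N \<in> null_sets M"
  obtains E :: "nat \<Rightarrow> _" and d where "\<And>j. determined_by {..<d j} (E j)"
    "summable (\<lambda>j. measure M (E j))" "N \<subseteq> {x. \<exists>\<^sub>\<infinity>j. x \<in> E j}"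
proof -
  have "\<exists>C. (\<forall>i::nat. \<exists>n. determined_by {..<n} (C i)) \<and> N \<subseteq> (\<Union>i. C i) \<and>
      summable (\<lambda>i. measure M (C i)) \<and> (\<Sum>i. measure M (C i)) < (1/2)^k" for k :: nat
  proof -
    have "N \<in> sets M" "measure M N = 0"
      using N by (auto simp: null_sets_def measure_def)
    moreover have "(0::real) < (1/2)^k"
      by simp
    ultimately obtain C where "\<And>i::nat. \<exists>n. determined_by {..<n} (C i)" "N \<subseteq> (\<Union>i. C i)"
        "summable (\<lambda>i. measure M (C i))" "(\<Sum>i. measure M (C i)) < 0 + (1/2)^k"
      using finite_coordinate_cover[of N "(1/2)^k"] by metis
    then show ?thesis
      by (intro exI[of _ C]) simp
  qed
  then obtain C where C: "\<And>k i. \<exists>n. determined_by {..<n} (C k i)" "\<And>k. N \<subseteq> (\<Union>i::nat. C k i)"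
      "\<And>k. summable (\<lambda>i. measure M (C k i))" "\<And>k::nat. (\<Sum>i. measure M (C k i)) < (1/2)^k"
    by metis
  obtain d where d: "\<And>k i. determined_by {..<d k i} (C k i)"
    using C(1) by metis
  define E where "E j = case_prod C (prod_decode j)" for j
  have "(\<Sum>j. ennreal (measure M (E j))) = (\<Sum>j. (\<lambda>(k, i). ennreal (measure M (C k i))) (prod_decode j))"
    by (simp only: E_def case_prod_beta)
  also have "\<dots> = (\<Sum>k. \<Sum>i. ennreal (measure M (C k i)))"
    by (rule suminf_ennreal_2dimen) (simp only: prod.case)
  also have "\<dots> \<le> (\<Sum>k. ennreal ((1/2)^k))"
  proof (intro suminf_le summableI)
    show "(\<Sum>i. ennreal (measure M (C k i))) \<le> ennreal ((1/2)^k)" for k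
      unfolding suminf_ennreal2[OF measure_nonneg C(3)] by (intro ennreal_leI less_imp_le C(4))
  qed
  also have "\<dots> < top"
    unfolding less_top[symmetric] by (intro ennreal_suminf_neq_top summable_geometric) auto
  finally have "summable (\<lambda>j. measure M (E j))"
    by (intro summable_suminf_not_top) auto
  moreover have "\<exists>\<^sub>\<infinity>j. x \<in> E j" if x: "x \<in> N" for x
    unfolding INFM_nat_le
  proof
    fix k
    obtain i where "x \<in> C k i"
      using C(2) x by blast
    then have "x \<in> E (prod_encode (k, i))"
      by (simp add: E_def)
    then show "\<exists>j\<ge>k. x \<in> E j"
      using le_prod_encode_1 by blast
  qed
  moreover have "determined_by {..<case_prod d (prod_decode j)} (E j)" for j
    by (auto simp: E_def d split: prod.split)
  ultimately show thesis
    by (intro that[of "\<lambda>j. case_prod d (prod_decode j)" E]) auto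
qed

end

section \<open>Blocks and the grouping of indices in pairs\<close>

lemma strict_mono_block:
  fixes n :: "nat \<Rightarrow> nat"
  assumes n: "strict_mono n" "n 0 = 0"
  obtains k where "n k \<le> i" "i < n (Suc k)"
proof -
  define k where "k = (LEAST k. i < n (Suc k))"
  have "i < n (Suc i)"
    using strict_mono_imp_increasing[OF n(1), of "Suc i"] by simp
  then have lt: "i < n (Suc k)"
    unfolding k_def by (rule LeastI)
  have "n k \<le> i"
  proof (cases k)
    case (Suc l)
    then have "\<not> i < n (Suc l)"
      using not_less_Least[of l "\<lambda>k. i < n (Suc k)"] by (simp add: k_def)
    with Suc show ?thesis by simp
  qed (simp add: n)
  with lt that show thesis by blast
qed

lemma INFM_even_odd: "(\<exists>\<^sub>\<infinity>j. P j) \<Longrightarrow> (\<exists>\<^sub>\<infinity>k. P (2 * k) \<or> P (2 * k + 1))"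
  for P :: "nat \<Rightarrow> bool"
  unfolding INFM_nat_le
proof
  fix m assume "\<forall>m. \<exists>n\<ge>m. P n"
  then obtain n where "n \<ge> 2 * m" "P n" by blast
  then show "\<exists>n\<ge>m. P (2 * n) \<or> P (2 * n + 1)"
    by (intro exI[of _ "n div 2"]) (cases "even n"; auto)
qed

text \<open>This grouping attaches to an even index its predecessor, as needed for events that live
  on the even block shared by two neighbours. At \<open>k = 0\<close> truncated subtraction merely
  repeats index 0.\<close>

lemma INFM_even_pred: "(\<exists>\<^sub>\<infinity>j. P j) \<Longrightarrow> (\<exists>\<^sub>\<infinity>k. P (2 * k) \<or> P (2 * k - 1))"
  for P :: "nat \<Rightarrow> bool"
  unfolding INFM_nat_le
proof
  fix m assume "\<forall>m. \<exists>n\<ge>m. P n"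
  then obtain n where "n \<ge> 2 * m" "P n" by blast
  then show "\<exists>n\<ge>m. P (2 * n) \<or> P (2 * n - 1)"
    by (intro exI[of _ "(n + 1) div 2"]) (cases "even n"; auto elim!: oddE)
qed

section \<open>Small sets against null sets\<close>

context biased_coins
begin

text \<open>An event determined by a block is recovered from its trace on that block, so the traces
  serve as the sets \<open>J k\<close>.\<close>

lemma mu_smallI:
  assumes n: "strict_mono n" "n 0 = 0" and S: "\<And>k. determined_by {n k..<n (Suc k)} (S k)"
    and sm: "summable (\<lambda>k. measure M (S k))" and H: "H \<subseteq> {x. \<exists>\<^sub>\<infinity>k. x \<in> S k}"
  shows "mu_small p H"
proof -
  define I where "I k = {n k..<n (Suc k)}" for k
  define J where "J k = (\<lambda>x. restrict x (I k)) ` S k" for k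
  have J: "restrict x (I k) \<in> J k \<longleftrightarrow> x \<in> S k" for x k
  proof
    assume "restrict x (I k) \<in> J k"
    then obtain y where y: "y \<in> S k" "restrict x (I k) = restrict y (I k)"
      by (auto simp: J_def)
    have "x i = y i" if "i \<in> I k" for i
      using fun_cong[OF y(2), of i] that by simp
    then show "x \<in> S k"
      using determined_byD[OF S, of k x y] y(1) by (simp add: I_def)
  qed (simp add: J_def)
  have "disjoint_family I"
  proof -
    have "I k \<inter> I l = {}" if "k < l" for k l
      using strict_mono_less_eq[OF n(1), of "Suc k" l] that by (auto simp: I_def)
    then show ?thesis
      unfolding disjoint_family_on_def by (metis Int_commute linorder_neqE_nat)
  qed
  moreover have "(\<Union>k. I k) = UNIV"
    using strict_mono_block[OF n] by (auto simp: I_def) (metis atLeastLessThan_iff)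
  moreover have "\<exists>a b. a < b \<and> I k = {a..<b}" for k
    using strict_monoD[OF n(1), of k "Suc k"] by (auto simp: I_def)
  moreover have "J k \<subseteq> I k \<rightarrow>\<^sub>E UNIV" for k
    by (auto simp: J_def)
  moreover have "(\<Sum>k. emeasure M {x \<in> space M. restrict x (I k) \<in> J k}) < \<infinity>"
  proof -
    have "emeasure M {x \<in> space M. restrict x (I k) \<in> J k} = ennreal (measure M (S k))" for k
      by (simp add: J M.emeasure_eq_measure)
    then show ?thesis
      unfolding infinity_ennreal_def less_top[symmetric]
      by (simp only:) (intro ennreal_suminf_neq_top sm measure_nonneg)
  qed
  ultimately show ?thesis
    using H unfolding mu_small_def by (intro exI[of _ I] exI[of _ J]) (auto simp: J)
qed

text \<open>The convergent half of Borel-Cantelli: the limit superior of the block events is the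
  required null set.\<close>

lemma mu_small_imp_null:
  assumes "mu_small p H"
  obtains N where "N \<in> null_sets M" "H \<subseteq> N"
proof -
  obtain I J where I: "\<forall>n::nat. \<exists>a b::nat. a < b \<and> I n = {a..<b}"
    and H: "H \<subseteq> {x. \<exists>\<^sub>\<infinity>n. restrict x (I n) \<in> J n}"
    and fin: "(\<Sum>n. emeasure M {x \<in> space M. restrict x (I n) \<in> J n}) < \<infinity>"
    using assms unfolding mu_small_def by (elim exE conjE) (rule that)
  define S where "S n = {x. restrict x (I n) \<in> J n}" for n
  have meas: "S n \<in> sets M" for n
  proof -
    obtain a b where ab: "I n = {a..<b}"
      using I by blast
    have "determined_by {..<b} (S n)"
      unfolding determined_by_def
    proof (intro allI impI)
      fix x y :: "nat \<Rightarrow> bool" assume xy: "\<forall>i\<in>{..<b}. x i = y i" "x \<in> S n"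
      have "restrict x (I n) = restrict y (I n)"
        using xy(1) by (intro restrict_ext) (auto simp: ab)
      with xy(2) show "y \<in> S n"
        by (simp add: S_def)
    qed
    then show ?thesis
      by (rule determined_by_sets)
  qed
  have "emeasure M {x \<in> space M. restrict x (I n) \<in> J n} = ennreal (measure M (S n))" for n
    by (simp add: S_def M.emeasure_eq_measure)
  then have "(\<Sum>n. ennreal (measure M (S n))) \<noteq> top"
    using fin by (simp only: infinity_ennreal_def less_top)
  then have "summable (\<lambda>n. measure M (S n))"
    by (intro summable_suminf_not_top measure_nonneg)
  then have "limsup S \<in> null_sets M"
    using meas by (intro borel_cantelli_limsup1) (auto simp: less_top[symmetric])
  moreover have "H \<subseteq> limsup S"
    using H by (auto simp: limsup_INF_SUP INFM_nat_le S_def)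
  ultimately show thesis
    by (rule that)
qed

text \<open>Every null set is caught infinitely often by events of rapidly decreasing measure that see only
  two consecutive blocks. Given the end \<open>a k\<close> of the past, the tail of a Borel--Cantelli cover is cut
  off so late that it remains small even after multiplication by the inverse of the least measure
  of a cylinder of length \<open>a k\<close>, which allows to forget the past.\<close>

lemma null_set_block_cover:
  assumes N: "N \<in> null_sets M"
  obtains a B where "strict_mono a" "a 0 = 0" "\<And>k. determined_by {a k..<a (k + 2)} (B k)"
    "\<And>k. measure M (B k) \<le> (1/4)^k" "N \<subseteq> {x. \<exists>\<^sub>\<infinity>k. x \<in> B k}"
proof -
  obtain E :: "nat \<Rightarrow> (nat \<Rightarrow> bool) set" and d where E: "\<And>j. determined_by {..<d j} (E j)"
      "summable (\<lambda>j. measure M (E j))" "N \<subseteq> {x. \<exists>\<^sub>\<infinity>j. x \<in> E j}"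
    by (rule null_set_infinitely_covered[OF N]) (rule that)
  have [measurable]: "E j \<in> sets M" for j
    using E(1) by (rule determined_by_sets)
  define c where "c n = (\<Prod>i<n. p i)" for n
  have c: "0 < c n" "c n \<le> measure M (cylinder n s)" for n s
    using p_pos by (auto simp: c_def prod_pos measure_cylinder_ge)
  have "\<exists>m\<ge>n. (\<Sum>i. measure M (E (i + m))) < (1/4)^n * c n" for n
  proof -
    obtain m0 where "\<And>m. m \<ge> m0 \<Longrightarrow> norm (\<Sum>i. measure M (E (i + m))) < (1/4)^n * c n"
      using suminf_exist_split[OF _ E(2), of "(1/4)^n * c n"] c(1) by auto
    from this[of "max m0 n"] show ?thesis
      by (intro exI[of _ "max m0 n"]) auto
  qed
  then obtain J where J: "\<And>n. n \<le> J n" "\<And>n. (\<Sum>i. measure M (E (i + J n))) < (1/4)^n * c n"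
    by metis
  \<comment> \<open>The sum bounds every \<open>d j\<close> with \<open>j < J n\<close>, so
    \<open>D k\<close> below sees only coordinates under \<open>a (k + 2)\<close>;
    \<open>Suc\<close> forces strict growth.\<close>
  define next_end where "next_end n = Suc (n + sum d {..<J n})" for n
  define a where "a k = (next_end ^^ k) 0" for k
  have a_Suc: "a (Suc k) = next_end (a k)" for k
    by (simp add: a_def)
  have mono: "strict_mono a"
    by (simp add: strict_mono_Suc_iff a_Suc next_end_def)
  define D where "D k = (\<Union>j\<in>{J (a k)..<J (a (Suc k))}. E j)" for k
  \<comment> \<open>The coordinates below \<open>a k\<close> are resampled. The threshold
    \<open>c (a k)\<close> cancels against the same factor in the bound on
    \<open>D k\<close>.\<close>
  define B where "B k = {x. c (a k) \<le> measure M {y. splice {a k..} x y \<in> D k}}" for k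
  have D_det: "determined_by {..<a (k + 2)} (D k)" for k
    unfolding D_def
  proof (rule determined_by_UN, rule determined_by_mono[OF E(1)])
    fix j assume "j \<in> {J (a k)..<J (a (Suc k))}"
    then have "d j \<le> sum d {..<J (a (Suc k))}"
      by (intro member_le_sum) auto
    also have "\<dots> \<le> a (k + 2)"
      by (simp add: a_Suc next_end_def)
    finally show "{..<d j} \<subseteq> {..<a (k + 2)}"
      by auto
  qed
  have [measurable]: "D k \<in> sets M" for k
    using D_det by (rule determined_by_sets)
  have D_le: "measure M (D k) \<le> (1/4)^k * c (a k)" for k
  proof -
    have "D k \<subseteq> (\<Union>i. E (i + J (a k)))"
    proof
      fix x assume "x \<in> D k"
      then obtain j where "x \<in> E j" "J (a k) \<le> j"
        by (auto simp: D_def)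
      then show "x \<in> (\<Union>i. E (i + J (a k)))"
        by (intro UN_I[of "j - J (a k)"]) auto
    qed
    then have "measure M (D k) \<le> measure M (\<Union>i. E (i + J (a k)))"
      by (intro M.finite_measure_mono) auto
    also have "\<dots> \<le> (\<Sum>i. measure M (E (i + J (a k))))"
      by (intro M.finite_measure_subadditive_countably summable_ignore_initial_segment E(2)) auto
    also have "\<dots> \<le> (1/4)^a k * c (a k)"
      using J(2) by (rule less_imp_le)
    also have "\<dots> \<le> (1/4)^k * c (a k)"
      using c(1)[of "a k"] strict_mono_imp_increasing[OF mono, of k]
      by (intro mult_right_mono power_decreasing) auto
    finally show ?thesis .
  qed
  show thesis
  proof (rule that[OF mono])
    show "a 0 = 0"
      by (simp add: a_def)
    show "determined_by {a k..<a (k + 2)} (B k)" for k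
      using determined_by_large_section[OF D_det[of k], of "{a k..}" "c (a k)"]
      by (simp add: B_def atLeastLessThan_def)
    show "measure M (B k) \<le> (1/4)^k" for k
    proof -
      have "measure M (B k) \<le> measure M (D k) / c (a k)"
        unfolding B_def using c(1) by (intro measure_large_section_le) auto
      also have "\<dots> \<le> (1/4)^k"
        using D_le[of k] c(1)[of "a k"] by (simp add: pos_divide_le_eq)
      finally show ?thesis .
    qed
    \<comment> \<open>The section at a point of \<open>D k\<close> contains the whole cylinder of
      length \<open>a k\<close> around it, so it reaches the threshold.\<close>
    have D_B: "D k \<subseteq> B k" for k
    proof
      fix x assume x: "x \<in> D k"
      have "splice {a k..} x y = x" if "y \<in> cylinder (a k) x" for y
        using that by (auto simp: splice_def cylinder_def)
      then have "measure M (cylinder (a k) x) \<le> measure M {y. splice {a k..} x y \<in> D k}"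
        using x by (intro M.finite_measure_mono section_sets) auto
      then show "x \<in> B k"
        using c(2)[of "a k" x] by (simp add: B_def)
    qed
    show "N \<subseteq> {x. \<exists>\<^sub>\<infinity>k. x \<in> B k}"
    proof safe
      fix x assume "x \<in> N"
      then have inf: "\<exists>\<^sub>\<infinity>j. x \<in> E j"
        using E(3) by blast
      show "\<exists>\<^sub>\<infinity>k. x \<in> B k"
        unfolding INFM_nat_le
      proof
        fix m
        obtain j where j: "J (a m) \<le> j" "x \<in> E j"
          using inf unfolding INFM_nat_le by blast
        \<comment> \<open>This finds the stage whose index range contains \<open>j\<close>: if
          \<open>k = m\<close> the lower bound is the choice of \<open>j\<close>, otherwise it is
          minimality.\<close>
        define k where "k = (LEAST k. m \<le> k \<and> j < J (a (Suc k)))"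
        have "j < J (a (Suc (max m j)))"
          using J(1)[of "a (Suc (max m j))"] strict_mono_imp_increasing[OF mono, of "Suc (max m j)"]
          by linarith
        then have "m \<le> max m j \<and> j < J (a (Suc (max m j)))"
          by simp
        then have "m \<le> k \<and> j < J (a (Suc k))"
          unfolding k_def by (rule LeastI)
        then have k: "m \<le> k" "j < J (a (Suc k))"
          by auto
        have "J (a k) \<le> j"
        proof (cases "k = m")
          case False
          then obtain l where l: "k = Suc l" "m \<le> l"
            using k(1) by (cases k) auto
          then have "\<not> j < J (a (Suc l))"
            using not_less_Least[of l "\<lambda>k. m \<le> k \<and> j < J (a (Suc k))"] by (simp add: k_def)
          with l show ?thesis by simp
        qed (use j in simp)
        with k j have "x \<in> D k"
          by (auto simp: D_def)
        with D_B k show "\<exists>k\<ge>m. x \<in> B k"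
          by blast
      qed
    qed
  qed
qed

text \<open>Splicing on the even blocks separates the two blocks seen by each \<open>B k\<close>. If some \<open>X\<close> in the
  filter leaves almost all sections \<open>T k\<close> of \<open>B k\<close> small, then for every \<open>Y\<close> in the filter the splice
  of \<open>X\<close> and \<open>Y\<close> contains \<open>X \<inter> Y\<close>, so it lies in infinitely many \<open>B k\<close> and \<open>Y\<close> lies in
  infinitely many \<open>T k\<close>. Otherwise the filter lies in the limit superior of the sets \<open>L k\<close>.\<close>

lemma filter_mu_smallI:
  assumes N: "N \<in> null_sets M" and F: "filter_chars F \<subseteq> N"
  shows "mu_small p (filter_chars F)"
proof -
  obtain a B where a: "strict_mono a" "a 0 = 0" and B: "\<And>k. determined_by {a k..<a (k + 2)} (B k)"
      "\<And>k. measure M (B k) \<le> (1/4)^k" "N \<subseteq> {x. \<exists>\<^sub>\<infinity>k. x \<in> B k}"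
    by (rule null_set_block_cover[OF N]) (rule that)
  have B_sets: "B k \<in> sets M" for k
    by (rule determined_by_sets[of "a (k + 2)"], rule determined_by_mono[OF B(1)]) auto
  have a2: "strict_mono (\<lambda>k. a (2 * k))"
    using a(1) by (auto simp: strict_mono_def)
  have a_le: "a k \<le> a l" if "k \<le> l" for k l
    using strict_mono_less_eq[OF a(1)] that by blast
  define Even where "Even = (\<Union>k. {a (2 * k)..<a (2 * k + 1)})"
  have not_Even: "i \<notin> Even" if "a (2 * k + 1) \<le> i" "i < a (2 * k + 2)" for i k
  proof
    assume "i \<in> Even"
    then obtain l where l: "a (2 * l) \<le> i" "i < a (2 * l + 1)"
      by (auto simp: Even_def)
    have "l \<le> k \<or> k < l" by auto
    then show False
      using a_le[of "2 * l + 1" "2 * k + 1"] a_le[of "2 * k + 2" "2 * l"] l that by auto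
  qed
  \<comment> \<open>The threshold \<open>(1/2)^k\<close> balances both cases: Markov leaves
    \<open>(1/4)^k / (1/2)^k = (1/2)^k\<close> for \<open>L k\<close>, and sections below it are
    summable too.\<close>
  define L where "L k = {x. (1/2)^k \<le> measure M {y. splice Even x y \<in> B k}}" for k
  have L_det: "determined_by (Even \<inter> {a k..<a (k + 2)}) (L k)" for k
    unfolding L_def by (rule determined_by_large_section[OF B(1)])
  have L_le: "measure M (L k) \<le> (1/2)^k" for k
  proof -
    have "measure M (L k) \<le> measure M (B k) / (1/2)^k"
      unfolding L_def by (intro measure_large_section_le B_sets) simp
    also have "\<dots> \<le> (1/4)^k / (1/2)^k"
      using B(2) by (intro divide_right_mono) auto
    also have "\<dots> = (1/2)^k"
      by (simp flip: power_divide)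
    finally show ?thesis .
  qed
  have L_sets: "L k \<in> sets M" for k
    unfolding L_def by (intro measure_large_section_le B_sets) simp
  show ?thesis
  proof (cases "filter_chars F \<subseteq> {x. \<exists>\<^sub>\<infinity>k. x \<in> L k}")
    case True
    show ?thesis
    proof (rule mu_smallI[OF a2])
      \<comment> \<open>Inside \<open>Even\<close>, the events with indices \<open>2 * k - 1\<close>
        and \<open>2 * k\<close> both see only block \<open>2 * k\<close>, hence this
        pairing.\<close>
      show "determined_by {a (2 * k)..<a (2 * Suc k)} (L (2 * k) \<union> L (2 * k - 1))" for k
      proof (rule determined_by_Un)
        show "determined_by {a (2 * k)..<a (2 * Suc k)} (L (2 * k))"
          using L_det[of "2 * k"] by (rule determined_by_mono) auto
        show "determined_by {a (2 * k)..<a (2 * Suc k)} (L (2 * k - 1))"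
        proof (rule determined_by_mono[OF L_det], safe)
          fix i assume i: "i \<in> Even" "i \<in> {a (2 * k - 1)..<a (2 * k - 1 + 2)}"
          have "a (2 * k) \<le> i"
          proof (cases k)
            case (Suc l)
            then show ?thesis
              using not_Even[of l i] i by (auto simp: not_le[symmetric])
          qed (simp add: a)
          moreover have "i < a (2 * Suc k)"
            using a_le[of "2 * k - 1 + 2" "2 * Suc k"] i(2) by auto
          ultimately show "i \<in> {a (2 * k)..<a (2 * Suc k)}" by simp
        qed
      qed
      show "summable (\<lambda>k. measure M (L (2 * k) \<union> L (2 * k - 1)))"
      proof (rule summable_comparison_test'[where N = 0])
        show "summable (\<lambda>k. 2 * (1/2)^k :: real)"
          by (intro summable_mult summable_geometric) simp
        fix k :: nat
        have "measure M (L (2 * k) \<union> L (2 * k - 1)) \<le> (1/2)^(2 * k) + (1/2)^(2 * k - 1)"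
          using L_le L_sets by (intro order_trans[OF measure_Un_le] add_mono) auto
        also have "\<dots> \<le> (1/2)^k + (1/2)^k"
          by (intro add_mono power_decreasing) auto
        finally show "norm (measure M (L (2 * k) \<union> L (2 * k - 1))) \<le> 2 * (1/2)^k"
          by simp
      qed
      show "filter_chars F \<subseteq> {x. \<exists>\<^sub>\<infinity>k. x \<in> L (2 * k) \<union> L (2 * k - 1)}"
        using True INFM_even_pred by (auto simp del: One_nat_def)
    qed (simp add: a)
  next
    case False
    then obtain X where X: "X \<in> filter_chars F" "\<not> (\<exists>\<^sub>\<infinity>k. X \<in> L k)"
      by blast
    define T where "T k = {y. splice Even X y \<in> B k}" for k
    have T_sets: "T k \<in> sets M" for k
      unfolding T_def by (intro section_sets B_sets)
    have T_det: "determined_by ({a k..<a (k + 2)} - Even) (T k)" for k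
      unfolding T_def by (rule determined_by_section[OF B(1)])
    obtain K where "\<And>k. k \<ge> K \<Longrightarrow> X \<notin> L k"
      using X(2) unfolding INFM_nat_le by blast
    then have T_le: "measure M (T k) \<le> (1/2)^k" if "k \<ge> K" for k
      using that by (force simp: L_def T_def)
    show ?thesis
    proof (rule mu_smallI[OF a2])
      \<comment> \<open>Off \<open>Even\<close>, the shared block is \<open>2 * k + 1\<close>, so
        the even index is now paired with its successor.\<close>
      show "determined_by {a (2 * k)..<a (2 * Suc k)} (T (2 * k) \<union> T (2 * k + 1))" for k
      proof (rule determined_by_Un)
        show "determined_by {a (2 * k)..<a (2 * Suc k)} (T (2 * k))"
          using T_det[of "2 * k"] by (rule determined_by_mono) auto
        show "determined_by {a (2 * k)..<a (2 * Suc k)} (T (2 * k + 1))"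
        proof (rule determined_by_mono[OF T_det], safe)
          fix i assume i: "i \<notin> Even" "i \<in> {a (2 * k + 1)..<a (2 * k + 1 + 2)}"
          have "\<not> a (2 * Suc k) \<le> i"
            using i by (auto simp: Even_def dest!: spec[of _ "Suc k"])
          then show "i \<in> {a (2 * k)..<a (2 * Suc k)}"
            using i(2) a_le[of "2 * k" "2 * k + 1"] by auto
        qed
      qed
      show "summable (\<lambda>k. measure M (T (2 * k) \<union> T (2 * k + 1)))"
      \<comment> \<open>The bound on \<open>T k\<close> is available only from \<open>K\<close> on,
        where \<open>X\<close> has left the sets \<open>L k\<close> for good.\<close>
      proof (rule summable_comparison_test'[where N = K])
        show "summable (\<lambda>k. 2 * (1/2)^k :: real)"
          by (intro summable_mult summable_geometric) simp
        fix k assume k: "k \<ge> K"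
        have "measure M (T (2 * k) \<union> T (2 * k + 1)) \<le> (1/2)^(2 * k) + (1/2)^(2 * k + 1)"
          using k by (intro order_trans[OF measure_Un_le[OF T_sets T_sets]] add_mono T_le) auto
        also have "\<dots> \<le> (1/2)^k + (1/2)^k"
          by (intro add_mono power_decreasing) auto
        finally show "norm (measure M (T (2 * k) \<union> T (2 * k + 1))) \<le> 2 * (1/2)^k"
          by simp
      qed
      have "\<exists>\<^sub>\<infinity>k. Y \<in> T k" if Y: "Y \<in> filter_chars F" for Y
      proof -
        have "eventually (splice Even X Y) F"
          using X(1) Y unfolding filter_chars_def mem_Collect_eq
          by eventually_elim (simp add: splice_def)
        then have "splice Even X Y \<in> N"
          using F by (auto simp: filter_chars_def)
        then show ?thesis
          using B(3) by (auto simp: T_def)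
      qed
      then show "filter_chars F \<subseteq> {y. \<exists>\<^sub>\<infinity>k. y \<in> T (2 * k) \<union> T (2 * k + 1)}"
        using INFM_even_odd by (auto simp del: One_nat_def)
    qed (simp add: a)
  qed
qed

end

theorem theorem1p1:
  fixes p :: "nat \<Rightarrow> real" and F :: "nat filter"
  assumes "\<forall>n. 0 < p n \<and> p n \<le> 1/2"
    and "F \<noteq> bot" and "F \<le> cofinite"
  shows "mu_measurable p (filter_chars F) \<longleftrightarrow> mu_small p (filter_chars F)"
proof -
  interpret biased_coins p
    using assms(1) by unfold_locales auto
  show ?thesis
  proof
    assume "mu_measurable p (filter_chars F)"
    then show "mu_small p (filter_chars F)"
      using filter_subset_null_set[OF assms(2,3)] filter_mu_smallI unfolding mu_measurable_def by blast
  next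
    assume "mu_small p (filter_chars F)"
    then obtain N where "N \<in> null_sets M" "filter_chars F \<subseteq> N"
      by (rule mu_small_imp_null)
    then show "mu_measurable p (filter_chars F)"
      \<comment> \<open>The measurable part is empty: the filter is a subset of a null set.\<close>
      unfolding mu_measurable_def by (intro sets_completionI[of _ "{}" "filter_chars F" N]) auto
  qed
qed

end
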